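(* Let $R$ be a zero-symmetric right near-ring, $M$ a faithful left $R$-module, and $v\in\{0,2,3,c\}$. If $M$ is a $v$-prime $R$-module, then $M$ is a $v$-classical prime $R$-module.
   Context: A right near-ring $(R,+,\cdot)$ is a (not necessarily abelian) group $(R,+)$ with an associative multiplication satisfying $(a+b)c=ac+bc$ (no identity assumed); it is zero-symmetric if $r0=0r=0$ for all $r$. A left $R$-module $M$ is a (not necessarily abelian) group $(M,+)$ with an action $R\times M\to M$ satisfying $(r_1+r_2)m=r_1m+r_2m$ and $(r_1r_2)m=r_1(r_2m)$. $M$ is faithful if $rM=0$ implies $r=0$. An $R$-submodule of $M$ is a subgroup $H$ with $RH\subseteq H$; an $R$-ideal of $M$ is a normal subgroup $P$ of $(M,+)$ with $r(m+n)-rm\in P$ for all $r\in R$, $m\in M$, $n\in P$. A left $R$-subgroup of $R$ is a subgroup $H$ of $(R,+)$ with $RH\subseteq H$. An ideal of $R$ is a normal subgroup $I$ of $(R,+)$ with $IR\subseteq I$ and $r_1(r_2+i)-r_1r_2\in I$ for all $r_1,r_2\in R$, $i\in I$. Products of subsets are elementwise. For an $R$-ideal $P$ of $M$ with $RM\nsubseteq P$, $P$ is called: - $0$-prime if for all ideals $A$ of $R$ and all $R$-submodules $B$ of $M$, $AB\subseteq P$ implies $AM\subseteq P$ or $B\subseteq P$; - $2$-prime if the same holds for all left $R$-subgroups $A$ of $R$ and all $R$-submodules $B$ of $M$; - $3$-prime if for all $a\in R$, $m\in M$, $aRm\subseteq P$ implies $aM\subseteq P$ or $m\in P$; - $c$-prime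 if for all $r\in R$, $m\in M$, $rm\in P$ implies $rM\subseteq P$ or $m\in P$. For an $R$-ideal $P$ of $M$ with $RM\nsubseteq P$, $P$ is called: - $0$-classical prime if for all ideals $A,B$ of $R$ and all $R$-submodules $N$ of $M$, $ABN\subseteq P$ implies $AN\subseteq P$ or $BN\subseteq P$; - $2$-classical prime if the same holds for all left $R$-subgroups $A,B$ of $R$ and all $R$-submodules $N$ of $M$; - $3$-classical prime if for all $a,b\in R$ and all $R$-submodules $N$ of $M$, $(aR)(bR)N\subseteq P$ implies $aN\subseteq P$ or $bN\subseteq P$; - $c$-classical prime if for all $a,b\in R$ and all $R$-submodules $N$ of $M$, $(aRb)N\subseteq P$ implies $aN\subseteq P$ or $bN\subseteq P$. The module $M$ is called $v$-prime (respectively $v$-classical prime) if $RM\neq 0$ and $\{0\}$ is a $v$-prime (respectively $v$-classical prime) $R$-ideal of $M$. *)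

theory Defs
  imports "HOL-Algebra.Coset" "HOL-Algebra.Module"
begin

(* Near-rings and near-ring modules live on the record types of HOL-Algebra's rings and modules;
   the field one of R and the fields mult and one of M carry no assumptions and are never used. *)

locale right_near_ring =
  fixes R :: "('a, 'c) ring_scheme" (structure)
  assumes add_group: "group (add_monoid R)"
    and mult_closed: "\<lbrakk>a \<in> carrier R; b \<in> carrier R\<rbrakk> \<Longrightarrow> a \<otimes> b \<in> carrier R"
    and mult_assoc: "\<lbrakk>a \<in> carrier R; b \<in> carrier R; c \<in> carrier R\<rbrakk>
        \<Longrightarrow> (a \<otimes> b) \<otimes> c = a \<otimes> (b \<otimes> c)"
    and right_distrib: "\<lbrakk>a \<in> carrier R; b \<in> carrier R; c \<in> carrier R\<rbrakk>
        \<Longrightarrow> (a \<oplus> b) \<otimes> c = (a \<otimes> c) \<oplus> (b \<otimes> c)"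

locale zero_symmetric_right_near_ring = right_near_ring +
  assumes mult_zero: "r \<in> carrier R \<Longrightarrow> r \<otimes> \<zero> = \<zero>"
    and zero_mult: "r \<in> carrier R \<Longrightarrow> \<zero> \<otimes> r = \<zero>"

locale near_ring_module = right_near_ring R
  for R :: "('a, 'c) ring_scheme" (structure) +
  fixes M :: "('a, 'b, 'd) module_scheme"
  assumes module_add_group: "group (add_monoid M)"
    and smult_closed: "\<lbrakk>r \<in> carrier R; m \<in> carrier M\<rbrakk> \<Longrightarrow> r \<odot>\<^bsub>M\<^esub> m \<in> carrier M"
    and smult_add: "\<lbrakk>r \<in> carrier R; s \<in> carrier R; m \<in> carrier M\<rbrakk>
        \<Longrightarrow> (r \<oplus> s) \<odot>\<^bsub>M\<^esub> m = (r \<odot>\<^bsub>M\<^esub> m) \<oplus>\<^bsub>M\<^esub> (s \<odot>\<^bsub>M\<^esub> m)"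
    and smult_mult: "\<lbrakk>r \<in> carrier R; s \<in> carrier R; m \<in> carrier M\<rbrakk>
        \<Longrightarrow> (r \<otimes> s) \<odot>\<^bsub>M\<^esub> m = r \<odot>\<^bsub>M\<^esub> (s \<odot>\<^bsub>M\<^esub> m)"

definition smult_set :: "('a, 'b, 'd) module_scheme \<Rightarrow> 'a set \<Rightarrow> 'b set \<Rightarrow> 'b set"
  where "smult_set M A N = {a \<odot>\<^bsub>M\<^esub> n | a n. a \<in> A \<and> n \<in> N}"

definition faithful_module :: "('a, 'c) ring_scheme \<Rightarrow> ('a, 'b, 'd) module_scheme \<Rightarrow> bool"
  where "faithful_module R M \<longleftrightarrow>
    (\<forall>r\<in>carrier R. smult_set M {r} (carrier M) = {\<zero>\<^bsub>M\<^esub>} \<longrightarrow> r = \<zero>\<^bsub>R\<^esub>)"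

definition R_submodule :: "('a, 'c) ring_scheme \<Rightarrow> ('a, 'b, 'd) module_scheme \<Rightarrow> 'b set \<Rightarrow> bool"
  where "R_submodule R M H \<longleftrightarrow>
    subgroup H (add_monoid M) \<and> smult_set M (carrier R) H \<subseteq> H"

definition R_ideal :: "('a, 'c) ring_scheme \<Rightarrow> ('a, 'b, 'd) module_scheme \<Rightarrow> 'b set \<Rightarrow> bool"
  where "R_ideal R M P \<longleftrightarrow>
    normal P (add_monoid M) \<and>
    (\<forall>r\<in>carrier R. \<forall>m\<in>carrier M. \<forall>n\<in>P.
       (r \<odot>\<^bsub>M\<^esub> (m \<oplus>\<^bsub>M\<^esub> n)) \<ominus>\<^bsub>M\<^esub> (r \<odot>\<^bsub>M\<^esub> m) \<in> P)"

definition left_R_subgroup :: "('a, 'c) ring_scheme \<Rightarrow> 'a set \<Rightarrow> bool"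
  where "left_R_subgroup R H \<longleftrightarrow>
    subgroup H (add_monoid R) \<and> carrier R <#>\<^bsub>R\<^esub> H \<subseteq> H"

definition near_ring_ideal :: "('a, 'c) ring_scheme \<Rightarrow> 'a set \<Rightarrow> bool"
  where "near_ring_ideal R I \<longleftrightarrow>
    normal I (add_monoid R) \<and> I <#>\<^bsub>R\<^esub> carrier R \<subseteq> I \<and>
    (\<forall>r\<in>carrier R. \<forall>s\<in>carrier R. \<forall>i\<in>I.
       (r \<otimes>\<^bsub>R\<^esub> (s \<oplus>\<^bsub>R\<^esub> i)) \<ominus>\<^bsub>R\<^esub> (r \<otimes>\<^bsub>R\<^esub> s) \<in> I)"

datatype prime_kind = V0 | V2 | V3 | Vc

fun prime_condition ::
  "prime_kind \<Rightarrow> ('a, 'c) ring_scheme \<Rightarrow> ('a, 'b, 'd) module_scheme \<Rightarrow> 'b set \<Rightarrow> bool"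
  where
    "prime_condition V0 R M P \<longleftrightarrow>
      (\<forall>A B. near_ring_ideal R A \<longrightarrow> R_submodule R M B \<longrightarrow> smult_set M A B \<subseteq> P \<longrightarrow>
         smult_set M A (carrier M) \<subseteq> P \<or> B \<subseteq> P)"
  | "prime_condition V2 R M P \<longleftrightarrow>
      (\<forall>A B. left_R_subgroup R A \<longrightarrow> R_submodule R M B \<longrightarrow> smult_set M A B \<subseteq> P \<longrightarrow>
         smult_set M A (carrier M) \<subseteq> P \<or> B \<subseteq> P)"
  | "prime_condition V3 R M P \<longleftrightarrow>
      (\<forall>a\<in>carrier R. \<forall>m\<in>carrier M. smult_set M (a <#\<^bsub>R\<^esub> carrier R) {m} \<subseteq> P \<longrightarrow>
         smult_set M {a} (carrier M) \<subseteq> P \<or> m \<in> P)"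
  | "prime_condition Vc R M P \<longleftrightarrow>
      (\<forall>r\<in>carrier R. \<forall>m\<in>carrier M. r \<odot>\<^bsub>M\<^esub> m \<in> P \<longrightarrow>
         smult_set M {r} (carrier M) \<subseteq> P \<or> m \<in> P)"

fun classical_prime_condition ::
  "prime_kind \<Rightarrow> ('a, 'c) ring_scheme \<Rightarrow> ('a, 'b, 'd) module_scheme \<Rightarrow> 'b set \<Rightarrow> bool"
  where
    "classical_prime_condition V0 R M P \<longleftrightarrow>
      (\<forall>A B N. near_ring_ideal R A \<longrightarrow> near_ring_ideal R B \<longrightarrow> R_submodule R M N \<longrightarrow>
         smult_set M (A <#>\<^bsub>R\<^esub> B) N \<subseteq> P \<longrightarrow>
         smult_set M A N \<subseteq> P \<or> smult_set M B N \<subseteq> P)"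
  | "classical_prime_condition V2 R M P \<longleftrightarrow>
      (\<forall>A B N. left_R_subgroup R A \<longrightarrow> left_R_subgroup R B \<longrightarrow> R_submodule R M N \<longrightarrow>
         smult_set M (A <#>\<^bsub>R\<^esub> B) N \<subseteq> P \<longrightarrow>
         smult_set M A N \<subseteq> P \<or> smult_set M B N \<subseteq> P)"
  | "classical_prime_condition V3 R M P \<longleftrightarrow>
      (\<forall>a\<in>carrier R. \<forall>b\<in>carrier R. \<forall>N. R_submodule R M N \<longrightarrow>
         smult_set M ((a <#\<^bsub>R\<^esub> carrier R) <#>\<^bsub>R\<^esub> (b <#\<^bsub>R\<^esub> carrier R)) N \<subseteq> P \<longrightarrow>
         smult_set M {a} N \<subseteq> P \<or> smult_set M {b} N \<subseteq> P)"
  | "classical_prime_condition Vc R M P \<longleftrightarrow>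
      (\<forall>a\<in>carrier R. \<forall>b\<in>carrier R. \<forall>N. R_submodule R M N \<longrightarrow>
         smult_set M ((a <#\<^bsub>R\<^esub> carrier R) #>\<^bsub>R\<^esub> b) N \<subseteq> P \<longrightarrow>
         smult_set M {a} N \<subseteq> P \<or> smult_set M {b} N \<subseteq> P)"

definition prime_R_ideal ::
  "prime_kind \<Rightarrow> ('a, 'c) ring_scheme \<Rightarrow> ('a, 'b, 'd) module_scheme \<Rightarrow> 'b set \<Rightarrow> bool"
  where "prime_R_ideal v R M P \<longleftrightarrow>
    R_ideal R M P \<and> \<not> smult_set M (carrier R) (carrier M) \<subseteq> P \<and> prime_condition v R M P"

definition classical_prime_R_ideal ::
  "prime_kind \<Rightarrow> ('a, 'c) ring_scheme \<Rightarrow> ('a, 'b, 'd) module_scheme \<Rightarrow> 'b set \<Rightarrow> bool"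
  where "classical_prime_R_ideal v R M P \<longleftrightarrow>
    R_ideal R M P \<and> \<not> smult_set M (carrier R) (carrier M) \<subseteq> P \<and>
    classical_prime_condition v R M P"

definition prime_R_module ::
  "prime_kind \<Rightarrow> ('a, 'c) ring_scheme \<Rightarrow> ('a, 'b, 'd) module_scheme \<Rightarrow> bool"
  where "prime_R_module v R M \<longleftrightarrow>
    smult_set M (carrier R) (carrier M) \<noteq> {\<zero>\<^bsub>M\<^esub>} \<and> prime_R_ideal v R M {\<zero>\<^bsub>M\<^esub>}"

definition classical_prime_R_module ::
  "prime_kind \<Rightarrow> ('a, 'c) ring_scheme \<Rightarrow> ('a, 'b, 'd) module_scheme \<Rightarrow> bool"
  where "classical_prime_R_module v R M \<longleftrightarrow>
    smult_set M (carrier R) (carrier M) \<noteq> {\<zero>\<^bsub>M\<^esub>} \<and>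
    classical_prime_R_ideal v R M {\<zero>\<^bsub>M\<^esub>}"

end

theory Submission
  imports Defs
begin

text \<open>
  Primeness lets one cancel a single factor: from \<open>A B \<subseteq> P\<close> it gives \<open>A M \<subseteq> P\<close> or \<open>B \<subseteq> P\<close>.
  The classical condition concerns two factors acting on a submodule \<open>N\<close>, and the passage from one
  to the other is associativity, \<open>(A B) N = A (B N)\<close>. If \<open>A N\<close> is not inside \<open>P\<close>, then neither is
  \<open>A M\<close>, so primeness cancels \<open>A\<close> and leaves \<open>B N \<subseteq> P\<close>.

  Two obstacles come from the missing left distributivity. First, \<open>B N\<close> need not be closed under
  addition, so primeness is applied to one \<open>n \<in> N\<close> at a time: right distributivity makes \<open>B n\<close> a
  submodule as soon as \<open>B\<close> is a left \<open>R\<close>-subgroup. Second, \<open>r 0 = 0\<close> is not automatic in a near-ring;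
  zero symmetry gives it in \<open>R\<close>, whence every ideal of \<open>R\<close> is a left \<open>R\<close>-subgroup, and through the
  action also in \<open>M\<close>, whence \<open>R P \<subseteq> P\<close> for every \<open>R\<close>-ideal \<open>P\<close>.

  For the two elementwise notions, cancelling \<open>a\<close> leaves a superfluous ring element: \<open>b s n \<in> P\<close> for
  all \<open>s\<close> in the 3-prime case, \<open>r b n \<in> P\<close> for all \<open>r\<close> in the c-prime case. A second application of
  primeness finishes: the former yields \<open>b M \<subseteq> P\<close> or \<open>n \<in> P\<close>, and \<open>b n \<in> P\<close> either way because
  \<open>R P \<subseteq> P\<close>; in the latter an \<open>r\<close> with \<open>r M\<close> not inside \<open>P\<close> exists and can be cancelled.

  The argument works for any \<open>R\<close>-ideal \<open>P\<close>; the module statement is \<open>P = {0}\<close>.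
\<close>

locale zero_symmetric_near_ring_module =
  zero_symmetric_right_near_ring R + near_ring_module R M
  for R :: "('a, 'c) ring_scheme" (structure) and M :: "('a, 'b, 'd) module_scheme"
begin

sublocale add: group "add_monoid R"
  rewrites "carrier (add_monoid R) = carrier R"
    and "mult (add_monoid R) = add R" and "one (add_monoid R) = zero R"
  by (simp_all add: add_group)

sublocale madd: group "add_monoid M"
  rewrites "carrier (add_monoid M) = carrier M"
    and "mult (add_monoid M) = add M" and "one (add_monoid M) = zero M"
  by (simp_all add: module_add_group)

lemma zero_smult:
  assumes "m \<in> carrier M"
  shows "\<zero> \<odot>\<^bsub>M\<^esub> m = \<zero>\<^bsub>M\<^esub>"
proof -
  have "\<zero> \<odot>\<^bsub>M\<^esub> m = (\<zero> \<odot>\<^bsub>M\<^esub> m) \<oplus>\<^bsub>M\<^esub> (\<zero> \<odot>\<^bsub>M\<^esub> m)"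
    using smult_add[of "\<zero>" "\<zero>" m] assms by simp
  then show ?thesis
    using assms smult_closed[of "\<zero>" m] madd.l_cancel_one by (metis add.one_closed)
qed

text \<open>Left multiplication need not be additive, so the zero of \<open>M\<close> is first written as \<open>0 m\<close>, and
  then \<open>r (0 m) = (r 0) m\<close> reduces the claim to zero symmetry of \<open>R\<close>.\<close>

lemma smult_zero:
  assumes "r \<in> carrier R"
  shows "r \<odot>\<^bsub>M\<^esub> \<zero>\<^bsub>M\<^esub> = \<zero>\<^bsub>M\<^esub>"
  using smult_mult[of r "\<zero>" "\<zero>\<^bsub>M\<^esub>"] zero_smult[of "\<zero>\<^bsub>M\<^esub>"] mult_zero[OF assms] assms
  by simp

text \<open>Put \<open>m = 0\<close> in the defining condition \<open>r (m + n) - r m \<in> P\<close>.\<close>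

lemma R_ideal_smult_closed:
  assumes P: "R_ideal R M P" and r: "r \<in> carrier R" and n: "n \<in> P"
  shows "r \<odot>\<^bsub>M\<^esub> n \<in> P"
proof -
  have "subgroup P (add_monoid M)"
    using P by (simp add: R_ideal_def normal_def)
  then have nM: "n \<in> carrier M"
    using n subgroup.subset by fastforce
  have "(r \<odot>\<^bsub>M\<^esub> (\<zero>\<^bsub>M\<^esub> \<oplus>\<^bsub>M\<^esub> n)) \<ominus>\<^bsub>M\<^esub> (r \<odot>\<^bsub>M\<^esub> \<zero>\<^bsub>M\<^esub>) \<in> P"
    using P r n madd.one_closed unfolding R_ideal_def by blast
  then show ?thesis
    using nM r smult_closed[OF r nM] madd.inv_one
    by (simp add: a_minus_def a_inv_def smult_zero)
qed

text \<open>The same substitution, this time of zero for \<open>s\<close> in \<open>r (s + i) - r s \<in> I\<close>, turns ideals of \<open>R\<close>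
  into left \<open>R\<close>-subgroups.\<close>

lemma near_ring_ideal_left_R_subgroup:
  assumes I: "near_ring_ideal R I"
  shows "left_R_subgroup R I"
proof -
  have sub: "subgroup I (add_monoid R)"
    using I by (simp add: near_ring_ideal_def normal_def)
  have "r \<otimes> i \<in> I" if r: "r \<in> carrier R" and i: "i \<in> I" for r i
  proof -
    have iR: "i \<in> carrier R"
      using sub i subgroup.subset by fastforce
    have "(r \<otimes> (\<zero> \<oplus> i)) \<ominus> (r \<otimes> \<zero>) \<in> I"
      using I r i add.one_closed unfolding near_ring_ideal_def by blast
    then show ?thesis
      using iR r mult_closed[OF r iR] add.inv_one
      by (simp add: a_minus_def a_inv_def mult_zero)
  qed
  then show ?thesis
    using sub by (auto simp: left_R_subgroup_def set_mult_def)
qed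

text \<open>Right distributivity makes \<open>b \<mapsto> b n\<close> a homomorphism of additive groups, so \<open>B n\<close> is the image
  of a subgroup. With a set of module elements in place of \<open>n\<close> this can fail, which is why the proofs
  below proceed elementwise in \<open>N\<close>.\<close>

lemma left_R_subgroup_smult_R_submodule:
  assumes B: "left_R_subgroup R B" and n: "n \<in> carrier M"
  shows "R_submodule R M (smult_set M B {n})"
proof -
  have sub: "subgroup B (add_monoid R)" and RB: "carrier R <#> B \<subseteq> B"
    using B by (simp_all add: left_R_subgroup_def)
  have BR: "B \<subseteq> carrier R"
    using subgroup.subset[OF sub] by simp
  have hom: "(\<lambda>b. b \<odot>\<^bsub>M\<^esub> n) \<in> hom (add_monoid R) (add_monoid M)"
    using n by (auto simp: hom_def smult_add smult_closed)
  interpret h: group_hom "add_monoid R" "add_monoid M" "\<lambda>b. b \<odot>\<^bsub>M\<^esub> n"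
    using hom add_group module_add_group by (simp add: group_hom_def group_hom_axioms_def)
  have eq: "smult_set M B {n} = (\<lambda>b. b \<odot>\<^bsub>M\<^esub> n) ` B"
    by (auto simp: smult_set_def)
  have closed: "r \<odot>\<^bsub>M\<^esub> (b \<odot>\<^bsub>M\<^esub> n) \<in> smult_set M B {n}" if "r \<in> carrier R" "b \<in> B" for r b
  proof -
    have "r \<otimes> b \<in> B"
      using RB that by (auto simp: set_mult_def)
    then show ?thesis
      using smult_mult[of r b n] that BR n by (force simp: smult_set_def)
  qed
  have "subgroup (smult_set M B {n}) (add_monoid M)"
    unfolding eq by (rule h.subgroup_img_is_subgroup[OF sub])
  moreover have "smult_set M (carrier R) (smult_set M B {n}) \<subseteq> smult_set M B {n}"
    using closed by (auto simp: smult_set_def[of M "carrier R"] eq)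
  ultimately show ?thesis
    by (simp add: R_submodule_def)
qed

text \<open>Both setwise notions are instances of this lemma: \<open>A\<close> ranges over the ideals of \<open>R\<close> or over its
  left \<open>R\<close>-subgroups, and the hypothesis \<open>prime\<close> is primeness with this \<open>A\<close> fixed.\<close>

lemma smult_cancel_left_R_subgroup:
  assumes prime: "\<And>H. R_submodule R M H \<Longrightarrow> smult_set M A H \<subseteq> P
      \<Longrightarrow> smult_set M A (carrier M) \<subseteq> P \<or> H \<subseteq> P"
    and A: "A \<subseteq> carrier R" and B: "left_R_subgroup R B" and N: "N \<subseteq> carrier M"
    and ABN: "smult_set M (A <#> B) N \<subseteq> P"
  shows "smult_set M A N \<subseteq> P \<or> smult_set M B N \<subseteq> P"
proof (rule disj_imp[THEN iffD2, OF impI])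
  assume "\<not> smult_set M A N \<subseteq> P"
  then have AM: "\<not> smult_set M A (carrier M) \<subseteq> P"
    using N by (fastforce simp: smult_set_def)
  have BR: "B \<subseteq> carrier R"
    using B subgroup.subset by (fastforce simp: left_R_subgroup_def)
  have "smult_set M B {n} \<subseteq> P" if n: "n \<in> N" for n
  proof -
    have "a \<odot>\<^bsub>M\<^esub> (b \<odot>\<^bsub>M\<^esub> n) \<in> P" if ab: "a \<in> A" "b \<in> B" for a b
    proof -
      have "(a \<otimes> b) \<odot>\<^bsub>M\<^esub> n \<in> P"
        using ABN ab n unfolding smult_set_def set_mult_def by blast
      moreover have "(a \<otimes> b) \<odot>\<^bsub>M\<^esub> n = a \<odot>\<^bsub>M\<^esub> (b \<odot>\<^bsub>M\<^esub> n)"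
        using ab n A BR N by (intro smult_mult) auto
      ultimately show ?thesis
        by simp
    qed
    then have "smult_set M A (smult_set M B {n}) \<subseteq> P"
      by (auto simp: smult_set_def)
    moreover have "R_submodule R M (smult_set M B {n})"
      using left_R_subgroup_smult_R_submodule[OF B] n N by blast
    ultimately show ?thesis
      using prime AM by blast
  qed
  then show "smult_set M B N \<subseteq> P"
    by (auto simp: smult_set_def)
qed

lemma prime_condition_V3_classical:
  assumes P: "R_ideal R M P" and prime: "prime_condition V3 R M P"
  shows "classical_prime_condition V3 R M P"
  unfolding classical_prime_condition.simps
proof (intro ballI allI impI, rule disj_imp[THEN iffD2, OF impI])
  fix a b N
  assume a: "a \<in> carrier R" and b: "b \<in> carrier R" and N: "R_submodule R M N"
    and abN: "smult_set M ((a <# carrier R) <#> (b <# carrier R)) N \<subseteq> P"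
    and aN: "\<not> smult_set M {a} N \<subseteq> P"
  have NM: "N \<subseteq> carrier M"
    using N subgroup.subset by (fastforce simp: R_submodule_def)
  have aM: "\<not> smult_set M {a} (carrier M) \<subseteq> P"
    using aN NM by (fastforce simp: smult_set_def)
  have cancel: "smult_set M {c} (carrier M) \<subseteq> P \<or> m \<in> P"
    if "c \<in> carrier R" "m \<in> carrier M"
      and "\<And>r. r \<in> carrier R \<Longrightarrow> (c \<otimes> r) \<odot>\<^bsub>M\<^esub> m \<in> P" for c m
  proof -
    have "smult_set M (c <# carrier R) {m} \<subseteq> P"
      using that(3) by (auto simp: smult_set_def l_coset_def)
    then show ?thesis
      using prime that(1,2) by simp
  qed
  have bsn: "(b \<otimes> s) \<odot>\<^bsub>M\<^esub> n \<in> P" if s: "s \<in> carrier R" and n: "n \<in> N" for s n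
  proof -
    have "(a \<otimes> r) \<odot>\<^bsub>M\<^esub> ((b \<otimes> s) \<odot>\<^bsub>M\<^esub> n) \<in> P" if r: "r \<in> carrier R" for r
    proof -
      have "((a \<otimes> r) \<otimes> (b \<otimes> s)) \<odot>\<^bsub>M\<^esub> n \<in> P"
        using abN r s n unfolding smult_set_def set_mult_def l_coset_def by blast
      then show ?thesis
        using smult_mult[of "a \<otimes> r" "b \<otimes> s" n] a b r s n NM mult_closed by auto
    qed
    moreover have "(b \<otimes> s) \<odot>\<^bsub>M\<^esub> n \<in> carrier M"
      using b s n NM by (auto intro: smult_closed mult_closed)
    ultimately show ?thesis
      using cancel a aM by blast
  qed
  have "b \<odot>\<^bsub>M\<^esub> n \<in> P" if n: "n \<in> N" for n
  proof -
    have nM: "n \<in> carrier M"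
      using n NM by blast
    have "smult_set M {b} (carrier M) \<subseteq> P \<or> n \<in> P"
      by (rule cancel[OF b nM bsn[OF _ n]])
    then show ?thesis
      using R_ideal_smult_closed[OF P b] nM by (auto simp: smult_set_def)
  qed
  then show "smult_set M {b} N \<subseteq> P"
    by (auto simp: smult_set_def)
qed

lemma prime_condition_Vc_classical:
  assumes RM: "\<not> smult_set M (carrier R) (carrier M) \<subseteq> P"
    and prime: "prime_condition Vc R M P"
  shows "classical_prime_condition Vc R M P"
  unfolding classical_prime_condition.simps
proof (intro ballI allI impI, rule disj_imp[THEN iffD2, OF impI])
  fix a b N
  assume a: "a \<in> carrier R" and b: "b \<in> carrier R" and N: "R_submodule R M N"
    and abN: "smult_set M ((a <# carrier R) #> b) N \<subseteq> P"
    and aN: "\<not> smult_set M {a} N \<subseteq> P"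
  have NM: "N \<subseteq> carrier M"
    using N subgroup.subset by (fastforce simp: R_submodule_def)
  have aM: "\<not> smult_set M {a} (carrier M) \<subseteq> P"
    using aN NM by (fastforce simp: smult_set_def)
  \<comment> \<open>The middle factor of \<open>a R b\<close> must be cancelled too; the choice of \<open>r\<close> makes this possible.\<close>
  obtain r where r: "r \<in> carrier R" and rM: "\<not> smult_set M {r} (carrier M) \<subseteq> P"
    using RM by (fastforce simp: smult_set_def)
  have "b \<odot>\<^bsub>M\<^esub> n \<in> P" if n: "n \<in> N" for n
  proof -
    have nM: "n \<in> carrier M"
      using n NM by blast
    have bn: "b \<odot>\<^bsub>M\<^esub> n \<in> carrier M" and rbn: "r \<odot>\<^bsub>M\<^esub> (b \<odot>\<^bsub>M\<^esub> n) \<in> carrier M"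
      using b r nM by (simp_all add: smult_closed)
    have "((a \<otimes> r) \<otimes> b) \<odot>\<^bsub>M\<^esub> n \<in> P"
      using abN r n unfolding smult_set_def r_coset_def l_coset_def by blast
    then have "a \<odot>\<^bsub>M\<^esub> (r \<odot>\<^bsub>M\<^esub> (b \<odot>\<^bsub>M\<^esub> n)) \<in> P"
      using a b r nM bn by (simp add: smult_mult mult_closed)
    then have "r \<odot>\<^bsub>M\<^esub> (b \<odot>\<^bsub>M\<^esub> n) \<in> P"
      using prime a aM rbn by auto
    then show ?thesis
      using prime r rM bn by auto
  qed
  then show "smult_set M {b} N \<subseteq> P"
    by (auto simp: smult_set_def)
qed

lemma prime_R_ideal_classical:
  assumes "prime_R_ideal v R M P"
  shows "classical_prime_R_ideal v R M P"
proof -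
  have P: "R_ideal R M P" and RM: "\<not> smult_set M (carrier R) (carrier M) \<subseteq> P"
    and prime: "prime_condition v R M P"
    using assms by (simp_all add: prime_R_ideal_def)
  have AR: "A \<subseteq> carrier R" if "left_R_subgroup R A" for A
    using that subgroup.subset by (fastforce simp: left_R_subgroup_def)
  have NM: "N \<subseteq> carrier M" if "R_submodule R M N" for N
    using that subgroup.subset by (fastforce simp: R_submodule_def)
  have "classical_prime_condition v R M P"
  proof (cases v)
    case V0
    show ?thesis
      unfolding V0 classical_prime_condition.simps
    proof (intro allI impI)
      fix A B N
      assume A: "near_ring_ideal R A" and B: "near_ring_ideal R B"
        and N: "R_submodule R M N" and ABN: "smult_set M (A <#> B) N \<subseteq> P"
      show "smult_set M A N \<subseteq> P \<or> smult_set M B N \<subseteq> P"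
      proof (rule smult_cancel_left_R_subgroup[OF _ _ _ NM[OF N] ABN])
        show "smult_set M A (carrier M) \<subseteq> P \<or> H \<subseteq> P"
          if "R_submodule R M H" "smult_set M A H \<subseteq> P" for H
          using prime A that unfolding V0 by simp
      qed (use A B AR near_ring_ideal_left_R_subgroup in auto)
    qed
  next
    case V2
    show ?thesis
      unfolding V2 classical_prime_condition.simps
    proof (intro allI impI)
      fix A B N
      assume A: "left_R_subgroup R A" and B: "left_R_subgroup R B"
        and N: "R_submodule R M N" and ABN: "smult_set M (A <#> B) N \<subseteq> P"
      show "smult_set M A N \<subseteq> P \<or> smult_set M B N \<subseteq> P"
      proof (rule smult_cancel_left_R_subgroup[OF _ AR[OF A] B NM[OF N] ABN])
        show "smult_set M A (carrier M) \<subseteq> P \<or> H \<subseteq> P"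
          if "R_submodule R M H" "smult_set M A H \<subseteq> P" for H
          using prime A that unfolding V2 by simp
      qed
    qed
  next
    case V3
    then show ?thesis
      using prime_condition_V3_classical[OF P] prime by blast
  next
    case Vc
    then show ?thesis
      using prime_condition_Vc_classical[OF RM] prime by blast
  qed
  then show ?thesis
    using P RM by (simp add: classical_prime_R_ideal_def)
qed

end

theorem theorem39:
  fixes R :: "('a, 'c) ring_scheme"
    and M :: "('a, 'b, 'd) module_scheme"
    and v :: prime_kind
  assumes "zero_symmetric_right_near_ring R"
    and "near_ring_module R M"
    and "faithful_module R M"
    and "prime_R_module v R M"
  shows "classical_prime_R_module v R M"
proof -
  interpret zero_symmetric_near_ring_module R M
    using assms(1,2) by (rule zero_symmetric_near_ring_module.intro)
  show ?thesis
    using assms(4) prime_R_ideal_classical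
    by (simp add: prime_R_module_def classical_prime_R_module_def)
qed

end
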